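(* Let $g:\mathcal Z\times\Theta\times\mathcal U\to\mathbb R^s$ be a given mapping and assume that the random vectors $\mathbf Z$ (data) and $\mathbf U$ satisfy the generalized model equation $g(\mathbf Z,\boldsymbol\theta_0,\mathbf U)=\mathbf 0$. Let $T:\mathcal U\times\Theta\to\mathcal T\subseteq\mathbb R^q$, let $B_\alpha(\boldsymbol\theta)$ be Borel sets, and define $$\Gamma_\alpha(\mathbf z)=\{\boldsymbol\theta\in\Theta:\ \exists\,\mathbf u^*\in\mathcal U\text{ such that }g(\mathbf z,\boldsymbol\theta,\mathbf u^* )=\mathbf 0,\ T(\mathbf u^*,\boldsymbol\theta)\in B_\alpha(\boldsymbol\theta)\}.$$ (i) If $\mathbb P\{T(\mathbf U,\boldsymbol\theta)\in B_\alpha(\boldsymbol\theta)\}\ge\alpha$ for every $\boldsymbol\theta\in\Theta$, then $\mathbb P\{\boldsymbol\theta_0\in\Gamma_\alpha(\mathbf Z)\}\ge\alpha$ for $0<\alpha<1$. (ii) If only $\mathbb P\{T(\mathbf U,\boldsymbol\theta)\in B_\alpha(\boldsymbol\theta)\}\ge\alpha\{1+o(\delta')\}$ for every $\boldsymbol\theta\in\Theta$, then $\mathbb P\{\boldsymbol\theta_0\in\Gamma_\alpha(\mathbf Z)\}\ge\alpha\{1+o(\delta')\}$ for $0<\alpha<1$.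
   Context: $\Theta$ is an arbitrary parameter set and $\boldsymbol\theta_0\in\Theta$ the true parameter. $\mathbf U$ is a random vector with values in $\mathcal U\subset\mathbb R^r$ with known distribution; $\mathbf Z$ is a random vector with values in $\mathcal Z\subset\mathbb R^m$ on the same probability space. Measurability of the events is implicit. $\delta'>0$ is a small value which may depend on the sample size $n$; $o(\delta')$ denotes a quantity which, divided by $\delta'$, tends to $0$ as $\delta'\to0$. *)

theory Defs
  imports "HOL-Probability.Probability" "HOL-Library.Landau_Symbols"
begin

text \<open>
  Vectors of dimension \<open>k\<close> are the extensional functions on \<open>{..<k}\<close>, with the product (i.e. Borel)
  sigma-algebra. The dimension is a term and not a type because data and noise vectors usually
  grow with the sample size, so it has to be able to vary within one asymptotic statement.
\<close>

abbreviation Rvec :: "nat \<Rightarrow> (nat \<Rightarrow> real) measure" where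
  "Rvec k \<equiv> Pi\<^sub>M {..<k} (\<lambda>_. borel)"

abbreviation zero_Rvec :: "nat \<Rightarrow> nat \<Rightarrow> real" where
  "zero_Rvec k \<equiv> (\<lambda>j\<in>{..<k}. 0)"

definition repro_set ::
  "'p set \<Rightarrow> (nat \<Rightarrow> real) set \<Rightarrow> nat
    \<Rightarrow> ((nat \<Rightarrow> real) \<Rightarrow> 'p \<Rightarrow> (nat \<Rightarrow> real) \<Rightarrow> (nat \<Rightarrow> real))
    \<Rightarrow> ((nat \<Rightarrow> real) \<Rightarrow> 'p \<Rightarrow> (nat \<Rightarrow> real))
    \<Rightarrow> ('p \<Rightarrow> (nat \<Rightarrow> real) set) \<Rightarrow> (nat \<Rightarrow> real) \<Rightarrow> 'p set" where
  "repro_set \<Theta> \<U> s g T B z =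
     {\<theta> \<in> \<Theta>. \<exists>u\<in>\<U>. g z \<theta> u = zero_Rvec s \<and> T u \<theta> \<in> B \<theta>}"

text \<open>
  The relation \<open>p \<ge> \<alpha> {1 + o(\<delta>)}\<close> for quantities \<open>p\<close>, \<open>\<delta>\<close> that depend on a common index (a sample
  size, a tolerance, or both). The filter \<open>filtercomap \<delta> (at_right 0)\<close> expresses that the limit is
  taken as \<open>\<delta>\<close> tends to 0 from above; for a positive sequence \<open>\<delta>\<close> converging to 0 it coincides
  with \<open>sequentially\<close>.
\<close>

definition ge_one_plus_o :: "('i \<Rightarrow> real) \<Rightarrow> real \<Rightarrow> ('i \<Rightarrow> real) \<Rightarrow> bool" where
  "ge_one_plus_o p \<alpha> \<delta> \<longleftrightarrow>
     (\<exists>e \<in> o[filtercomap \<delta> (at_right 0)](\<delta>). \<forall>i. p i \<ge> \<alpha> * (1 + e i))"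

end

theory Submission imports Defs begin

text \<open>
  Where the model equation holds, the realised noise \<open>U\<close> is itself an admissible witness \<open>u\<^sup>*\<close> at the
  true parameter, so the event \<open>T (U, \<theta>\<^sub>0) \<in> B \<theta>\<^sub>0\<close> is almost surely contained in the coverage event.
\<close>

text \<open>The little-o condition constrains only the error term and not \<open>p\<close>, so the
  same error term serves for the larger quantity. This carries a comparison of probabilities, made
  separately at each index, over to the asymptotic statement.\<close>

lemma ge_one_plus_o_mono:
  assumes "ge_one_plus_o p \<alpha> \<delta>" and "\<And>i. p i \<le> p' i"
  shows "ge_one_plus_o p' \<alpha> \<delta>"
  using assms unfolding ge_one_plus_o_def by (meson order_trans)


theorem theorem2:
  fixes \<Theta> :: "'p set" and \<theta>\<^sub>0 :: 'p
    and \<delta>' :: "'i \<Rightarrow> real"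
    and M :: "'i \<Rightarrow> 'w measure"
    and r m s q :: "'i \<Rightarrow> nat"
    and \<U> \<Z> \<T> :: "'i \<Rightarrow> (nat \<Rightarrow> real) set"
    and U Z :: "'i \<Rightarrow> 'w \<Rightarrow> (nat \<Rightarrow> real)"
    and g :: "'i \<Rightarrow> (nat \<Rightarrow> real) \<Rightarrow> 'p \<Rightarrow> (nat \<Rightarrow> real) \<Rightarrow> (nat \<Rightarrow> real)"
    and T :: "'i \<Rightarrow> (nat \<Rightarrow> real) \<Rightarrow> 'p \<Rightarrow> (nat \<Rightarrow> real)"
    and B :: "'i \<Rightarrow> real \<Rightarrow> 'p \<Rightarrow> (nat \<Rightarrow> real) set"
    and \<Gamma> :: "'i \<Rightarrow> real \<Rightarrow> (nat \<Rightarrow> real) \<Rightarrow> 'p set"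
  assumes true_parameter: "\<theta>\<^sub>0 \<in> \<Theta>"
    and delta_pos: "\<And>i. \<delta>' i > 0"
    and prob: "\<And>i. prob_space (M i)"
    and U_range: "\<And>i. \<U> i \<subseteq> space (Rvec (r i))"
    and U_rv: "\<And>i. U i \<in> measurable (M i) (Rvec (r i))"
    and U_values: "\<And>i \<omega>. \<omega> \<in> space (M i) \<Longrightarrow> U i \<omega> \<in> \<U> i"
    and Z_range: "\<And>i. \<Z> i \<subseteq> space (Rvec (m i))"
    and Z_rv: "\<And>i. Z i \<in> measurable (M i) (Rvec (m i))"
    and Z_values: "\<And>i \<omega>. \<omega> \<in> space (M i) \<Longrightarrow> Z i \<omega> \<in> \<Z> i"
    and g_values: "\<And>i z \<theta> u. z \<in> \<Z> i \<Longrightarrow> \<theta> \<in> \<Theta> \<Longrightarrow> u \<in> \<U> i \<Longrightarrow> g i z \<theta> u \<in> space (Rvec (s i))"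
    and model_equation: "\<And>i. AE \<omega> in M i. g i (Z i \<omega>) \<theta>\<^sub>0 (U i \<omega>) = zero_Rvec (s i)"
    and T_range: "\<And>i. \<T> i \<subseteq> space (Rvec (q i))"
    and T_values: "\<And>i u \<theta>. u \<in> \<U> i \<Longrightarrow> \<theta> \<in> \<Theta> \<Longrightarrow> T i u \<theta> \<in> \<T> i"
    and B_borel: "\<And>i \<alpha> \<theta>. 0 < \<alpha> \<Longrightarrow> \<alpha> < 1 \<Longrightarrow> \<theta> \<in> \<Theta> \<Longrightarrow> B i \<alpha> \<theta> \<in> sets (Rvec (q i))"
    and Gamma: "\<And>i \<alpha> z. \<Gamma> i \<alpha> z = repro_set \<Theta> (\<U> i) (s i) (g i) (T i) (B i \<alpha>) z"
    and T_event: "\<And>i \<alpha> \<theta>. 0 < \<alpha> \<Longrightarrow> \<alpha> < 1 \<Longrightarrow> \<theta> \<in> \<Theta> \<Longrightarrow>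
           {\<omega> \<in> space (M i). T i (U i \<omega>) \<theta> \<in> B i \<alpha> \<theta>} \<in> sets (M i)"
    and Gamma_event: "\<And>i \<alpha>. 0 < \<alpha> \<Longrightarrow> \<alpha> < 1 \<Longrightarrow>
           {\<omega> \<in> space (M i). \<theta>\<^sub>0 \<in> \<Gamma> i \<alpha> (Z i \<omega>)} \<in> sets (M i)"
  shows "(\<forall>i \<alpha>. 0 < \<alpha> \<longrightarrow> \<alpha> < 1 \<longrightarrow>
             (\<forall>\<theta>\<in>\<Theta>. \<P>(\<omega> in M i. T i (U i \<omega>) \<theta> \<in> B i \<alpha> \<theta>) \<ge> \<alpha>) \<longrightarrow>
             \<P>(\<omega> in M i. \<theta>\<^sub>0 \<in> \<Gamma> i \<alpha> (Z i \<omega>)) \<ge> \<alpha>)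
       \<and> (\<forall>\<alpha>. 0 < \<alpha> \<longrightarrow> \<alpha> < 1 \<longrightarrow>
             (\<forall>\<theta>\<in>\<Theta>. ge_one_plus_o (\<lambda>i. \<P>(\<omega> in M i. T i (U i \<omega>) \<theta> \<in> B i \<alpha> \<theta>)) \<alpha> \<delta>') \<longrightarrow>
             ge_one_plus_o (\<lambda>i. \<P>(\<omega> in M i. \<theta>\<^sub>0 \<in> \<Gamma> i \<alpha> (Z i \<omega>))) \<alpha> \<delta>')"
proof -
  \<comment> \<open>Both parts rest on this comparison at a single index: it involves no lower bound
    on either side, so an exact and an approximate bound transfer through it alike.\<close>
  have cover: "\<P>(\<omega> in M i. T i (U i \<omega>) \<theta>\<^sub>0 \<in> B i \<alpha> \<theta>\<^sub>0) \<le> \<P>(\<omega> in M i. \<theta>\<^sub>0 \<in> \<Gamma> i \<alpha> (Z i \<omega>))"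
    if "0 < \<alpha>" "\<alpha> < 1" for i \<alpha>
  proof -
    interpret prob_space "M i" by (rule prob)
    show ?thesis
    \<comment> \<open>The model equation may fail on a null set, so the inclusion of events holds
      only almost surely and the almost-everywhere form of monotonicity is required.\<close>
    proof (rule finite_measure_mono_AE)
      show "AE \<omega> in M i. \<omega> \<in> {\<omega> \<in> space (M i). T i (U i \<omega>) \<theta>\<^sub>0 \<in> B i \<alpha> \<theta>\<^sub>0} \<longrightarrow>
          \<omega> \<in> {\<omega> \<in> space (M i). \<theta>\<^sub>0 \<in> \<Gamma> i \<alpha> (Z i \<omega>)}"
        using model_equation[of i]
        \<comment> \<open>With \<open>U i \<omega>\<close> as the witness in
          \<open>repro_set\<close>, membership in \<open>\<U> i\<close> comes from
          \<open>U_values\<close>, the equation from the almost sure event, and the condition on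
          \<open>T\<close> from the smaller event.\<close>
        by eventually_elim (use true_parameter U_values in \<open>auto simp: Gamma repro_set_def\<close>)
    \<comment> \<open>What is left is measurability of the larger event; the restriction of \<alpha>
      to the open unit interval enters here.\<close>
    qed (rule Gamma_event[OF that])
  qed
  \<comment> \<open>Both hypotheses are instantiated at \<open>\<theta>\<^sub>0\<close>. Part (i)
    follows by transitivity; in part (ii) the error term, which may vary with the parameter, is the
    one obtained at \<open>\<theta>\<^sub>0\<close>.\<close>
  show ?thesis
    using cover true_parameter by (meson order_trans ge_one_plus_o_mono)
qed

end
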